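(* Let $n\ge1$ be a degree. The error of the unitary best approximation for $\omega>0$ is bounded by $$\min_{u\in\mathcal{U}_n}\| u - \exp(\omega\cdot)\| \leq \frac{(n!)^2\, \omega^{2n+1}}{(2n)!\,(2n+1)!}.$$
   Context: For a complex polynomial $p$ let $p^\dag(z):=\overline{p}(-z)=\overline{p(-\overline z)}$, where $\overline p$ has complex-conjugated coefficients. Let $\mathcal{U}_n:=\{p^\dag/p : p \text{ a complex polynomial of degree}\le n,\ p\not\equiv 0\}$, with rational functions identified with their irreducible form; then $|u(\mathrm{i}x)|=1$ for $u\in\mathcal{U}_n$, $x\in\mathbb{R}$. For $u\in\mathcal{U}_n$, $\|u-\exp(\omega\cdot)\|:=\max_{x\in[-1,1]}|u(\mathrm{i}x)-\mathrm{e}^{\mathrm{i}\omega x}|$. The minimum over $\mathcal{U}_n$ is attained for every $\omega>0$. *)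

theory Defs
  imports
    "HOL-Analysis.Analysis"
    "HOL-Computational_Algebra.Field_as_Ring"
    "HOL-Computational_Algebra.Polynomial_Factorial"
    "HOL-Computational_Algebra.Normalized_Fraction"
begin

text \<open>
  The polynomial \<open>z \<mapsto> cnj (p (- cnj z))\<close>: conjugate the coefficients, then substitute \<open>-z\<close>.
\<close>

definition poly_dagger :: "complex poly \<Rightarrow> complex poly" where
  "poly_dagger p = pcompose (map_poly cnj p) [:0, -1:]"

lemma poly_poly_dagger: "poly (poly_dagger p) z = cnj (poly p (- cnj z))"
proof -
  have "poly (map_poly cnj p) w = cnj (poly p (cnj w))" for w
    by (induction p) (simp_all add: map_poly_pCons)
  then show ?thesis
    by (simp add: poly_dagger_def poly_pcompose)
qed

text \<open>
  Rational functions are elements of the fraction field of the polynomial ring, so \<open>p\<close> may have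
  zeros on the imaginary axis; these cancel in \<open>p\<^sup>\<dagger> / p\<close>.
\<close>

definition unitary_rats :: "nat \<Rightarrow> complex poly fract set" where
  "unitary_rats n = {Fract (poly_dagger p) p | p. p \<noteq> 0 \<and> degree p \<le> n}"

text \<open>
  The value of a rational function is that of its irreducible form: \<open>quot_of_fract\<close> returns the
  coprime numerator and denominator with monic denominator.
\<close>

definition rat_eval :: "complex poly fract \<Rightarrow> complex \<Rightarrow> complex" where
  "rat_eval u z = poly (fst (quot_of_fract u)) z / poly (snd (quot_of_fract u)) z"

lemma rat_eval_Fract:
  assumes "poly q z \<noteq> 0"
  shows "rat_eval (Fract p q) z = poly p z / poly q z"
proof -
  define a b where "a = fst (quot_of_fract (Fract p q))" and "b = snd (quot_of_fract (Fract p q))"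
  have q: "q \<noteq> 0" using assms by auto
  have b: "b \<noteq> 0" by (simp add: b_def)
  have cop: "coprime a b" by (simp add: a_def b_def coprime_quot_of_fract)
  have "Fract a b = Fract p q" by (simp add: a_def b_def)
  then have e: "a * q = p * b" using q b by (simp add: eq_fract)
  then have "b dvd a * q" by simp
  then have "b dvd q" using cop by (simp add: coprime_commute coprime_dvd_mult_right_iff)
  then have bz: "poly b z \<noteq> 0" using assms by (auto elim!: dvdE)
  have "poly a z * poly q z = poly p z * poly b z"
    using arg_cong[OF e, of "\<lambda>f. poly f z"] by simp
  then show ?thesis
    using bz assms by (simp add: rat_eval_def flip: a_def b_def) (simp add: field_simps)
qed

text \<open>
  For \<open>u \<in> unitary_rats n\<close> the irreducible form has no poles on the imaginary axis and is unimodular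
  there, so the function of \<open>x\<close> below is continuous on the compact interval and the supremum is a
  maximum.
\<close>

definition approx_error :: "real \<Rightarrow> complex poly fract \<Rightarrow> real" where
  "approx_error \<omega> u =
     (SUP x \<in> {-1..1}. cmod (rat_eval u (\<i> * of_real x) - exp (\<i> * of_real (\<omega> * x))))"

definition unitary_best_approx :: "nat \<Rightarrow> real \<Rightarrow> complex poly fract \<Rightarrow> bool" where
  "unitary_best_approx n \<omega> u \<longleftrightarrow> is_arg_min (approx_error \<omega>) (\<lambda>v. v \<in> unitary_rats n) u"

end

theory Submission
  imports Defs
begin

text \<open>
  A best approximation exists by compactness, and its error is at most that of one explicit member
  of the class, the diagonal Pade approximant of the exponential function.

  \<^emph>\<open>Existence.\<close> Scaling \<open>p\<close> by a positive number does not change \<open>p\<^sup>\<dagger> / p\<close>, so a minimising sequence of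
  denominators may be taken in the compact unit sphere of the coefficient space; pass to a limit \<open>p\<close>.
  Pointwise convergence of the quotients is only available where \<open>p\<close> does not vanish, which
  excludes finitely many points of the imaginary axis. There the irreducible form helps: it has no
  poles on the axis (\<open>irreducible_form_imaginary\<close>), so the error is a continuous function and a bound off finitely many
  points is a bound everywhere.

  \<^emph>\<open>Error of the Pade approximant.\<close> Its denominator is \<open>\<theta>\<^sub>n (- \<omega> z / 2)\<close> with the reverse Bessel
  polynomial \<open>\<theta>\<^sub>n\<close>. Put \<open>G\<^sub>n (y) = exp (- \<i> y) \<theta>\<^sub>n (\<i> y)\<close>. At the point \<open>\<i> x\<close>, with
  \<open>y = - \<omega> x / 2\<close>, the error equals \<open>2 \<bar>Im G\<^sub>n (y)\<bar> / \<bar>G\<^sub>n (y)\<bar>\<close>, and both parts are controlled by the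
  single relation \<open>G\<^sub>n\<^sub>+\<^sub>1' (y) = y G\<^sub>n (y)\<close>.
  Integrating it \<open>n\<close> times from \<open>\<bar>Im G\<^sub>0 (y)\<bar> = \<bar>sin y\<bar> \<le> \<bar>y\<bar>\<close> gives
  \<open>\<bar>Im G\<^sub>n (y)\<bar> \<le> \<bar>y\<bar>\<^sup>2\<^sup>n\<^sup>+\<^sup>1 / (2n+1)!!\<close> (\<open>Im_twisted_le\<close>).
  Together with the three-term recurrence it shows that \<open>\<bar>G\<^sub>n (y)\<bar>\<^sup>2\<close> is a polynomial in \<open>y\<^sup>2\<close> with
  nonnegative coefficients (\<open>twisted_modulus\<close>), so that \<open>\<bar>G\<^sub>n (y)\<bar> \<ge> G\<^sub>n (0) = (2n-1)!!\<close>.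
  For \<open>\<bar>y\<bar> \<le> \<omega> / 2\<close> the quotient is at most \<open>2 (\<omega>/2)\<^sup>2\<^sup>n\<^sup>+\<^sup>1 / ((2n+1)!! (2n-1)!!)\<close>, and writing the double
  factorials as \<open>(2n+1)! / (2\<^sup>n n!)\<close> and \<open>(2n)! / (2\<^sup>n n!)\<close> turns this into the stated bound.
\<close>

section \<open>Rational functions in the class on the imaginary axis\<close>

text \<open>
  Removing finitely many points from a nondegenerate interval leaves a dense subset. This carries
  estimates across the points of the imaginary axis where a denominator vanishes.
\<close>

lemma le_of_le_off_finite:
  fixes f :: "real \<Rightarrow> real"
  assumes "continuous_on UNIV f" "finite F" "a < b"
    and le: "\<And>x. x \<in> {a..b} - F \<Longrightarrow> f x \<le> c" and x: "x \<in> {a..b}"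
  shows "f x \<le> c"
proof -
  have "x islimpt {a..b}"
    using x \<open>a < b\<close> by (intro connected_imp_perfect) auto
  then have "x islimpt (F \<union> ({a..b} - F))"
    by (rule islimpt_subset) auto
  then have "x islimpt ({a..b} - F)"
    using islimpt_Un_finite[OF \<open>finite F\<close>] by blast
  then have "x \<in> closure ({a..b} - F)"
    by (simp add: closure_def)
  then show ?thesis
    using continuous_le_on_closure[of "{a..b} - F" f x c] le
      continuous_on_subset[OF assms(1) subset_UNIV] by blast
qed

lemma finite_imaginary_roots:
  assumes "(p :: complex poly) \<noteq> 0"
  shows "finite {x::real. poly p (\<i> * of_real x) = 0}"
proof -
  have "finite ((\<lambda>x::real. \<i> * of_real x) -` {z. poly p z = 0})"
    by (rule finite_vimageI) (auto simp: poly_roots_finite assms inj_def)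
  then show ?thesis by (simp add: vimage_def)
qed

text \<open>
  The imaginary axis is fixed by \<open>z \<mapsto> - cnj z\<close>, which is why the quotients are unimodular there.
\<close>

lemma poly_dagger_imaginary:
  "poly (poly_dagger p) (\<i> * of_real x) = cnj (poly p (\<i> * of_real x))"
  by (simp add: poly_poly_dagger)

lemma poly_dagger_smult: "poly_dagger (smult c p) = smult (cnj c) (poly_dagger p)"
  by (intro poly_eq_poly_eq_iff[THEN iffD1] ext) (simp add: poly_poly_dagger)

text \<open>
  Where \<open>p\<close> does not vanish, the moduli of numerator and denominator of the irreducible form agree
  because those of \<open>p\<^sup>\<dagger>\<close> and \<open>p\<close> do; by density they agree on the whole axis. A zero of the
  denominator on the axis would then also be a zero of the numerator, against coprimality.
\<close>

lemma irreducible_form_imaginary: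
  fixes x :: real
  assumes "p \<noteq> 0"
  defines "u \<equiv> Fract (poly_dagger p) p"
  shows "poly (snd (quot_of_fract u)) (\<i> * of_real x) \<noteq> 0 \<and>
    cmod (poly (fst (quot_of_fract u)) (\<i> * of_real x))
      = cmod (poly (snd (quot_of_fract u)) (\<i> * of_real x))"
proof -
  define a b where "a = fst (quot_of_fract u)" and "b = snd (quot_of_fract u)"
  have b: "b \<noteq> 0" by (simp add: b_def)
  have cop: "coprime a b" by (simp add: a_def b_def coprime_quot_of_fract)
  have "Fract a b = Fract (poly_dagger p) p" by (simp add: a_def b_def u_def)
  then have e: "a * p = poly_dagger p * b" using assms(1) b by (simp add: eq_fract)
  have off: "cmod (poly a (\<i> * of_real x)) = cmod (poly b (\<i> * of_real x))"
    if "poly p (\<i> * of_real x) \<noteq> 0" for x :: real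
  proof -
    have "poly a (\<i> * of_real x) * poly p (\<i> * of_real x)
        = cnj (poly p (\<i> * of_real x)) * poly b (\<i> * of_real x)"
      using arg_cong[OF e, of "\<lambda>q. poly q (\<i> * of_real x)"] by (simp add: poly_dagger_imaginary)
    then have "cmod (poly a (\<i> * of_real x)) * cmod (poly p (\<i> * of_real x))
        = cmod (poly p (\<i> * of_real x)) * cmod (poly b (\<i> * of_real x))"
      by (metis complex_mod_cnj norm_mult)
    then show ?thesis using that by simp
  qed
  have eq: "cmod (poly a (\<i> * of_real x)) = cmod (poly b (\<i> * of_real x))" for x :: real
  proof -
    have "\<bar>cmod (poly a (\<i> * of_real x)) - cmod (poly b (\<i> * of_real x))\<bar> \<le> 0"
    proof (rule le_of_le_off_finite[where a = "x - 1" and b = "x + 1"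
          and f = "\<lambda>x. \<bar>cmod (poly a (\<i> * of_real x)) - cmod (poly b (\<i> * of_real x))\<bar>"
          and F = "{x. poly p (\<i> * of_real x) = 0}"])
      show "continuous_on UNIV
          (\<lambda>x::real. \<bar>cmod (poly a (\<i> * of_real x)) - cmod (poly b (\<i> * of_real x))\<bar>)"
        by (intro continuous_intros)
    qed (use off in \<open>auto intro: finite_imaginary_roots[OF assms(1)]\<close>)
    then show ?thesis by simp
  qed
  have nz: "poly b (\<i> * of_real x) \<noteq> 0" for x :: real
  proof
    assume b0: "poly b (\<i> * of_real x) = 0"
    then have "poly a (\<i> * of_real x) = 0" using eq[of x] by simp
    with b0 show False
      using coprime_poly_0[OF cop] by blast
  qed
  show ?thesis
    using nz eq by (simp flip: a_def b_def)
qed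

lemma continuous_on_rat_eval_imaginary:
  assumes "p \<noteq> 0"
  shows "continuous_on UNIV (\<lambda>x::real. rat_eval (Fract (poly_dagger p) p) (\<i> * of_real x))"
  unfolding rat_eval_def
  by (intro continuous_intros) (use irreducible_form_imaginary[OF assms] in auto)

lemma norm_rat_eval_imaginary:
  assumes "p \<noteq> 0"
  shows "cmod (rat_eval (Fract (poly_dagger p) p) (\<i> * of_real x)) = 1"
  using irreducible_form_imaginary[OF assms, of x] by (simp add: rat_eval_def norm_divide)

lemma norm_diff_le_approx_error:
  assumes "p \<noteq> 0" "x \<in> {-1..1}"
  shows "cmod (rat_eval (Fract (poly_dagger p) p) (\<i> * of_real x) - exp (\<i> * of_real (\<omega> * x)))
    \<le> approx_error \<omega> (Fract (poly_dagger p) p)"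
  unfolding approx_error_def
proof (rule cSUP_upper[OF assms(2)])
  have "cmod (rat_eval (Fract (poly_dagger p) p) (\<i> * of_real x) - exp (\<i> * of_real (\<omega> * x))) \<le> 2"
    for x :: real
    using norm_triangle_ineq4[of "rat_eval (Fract (poly_dagger p) p) (\<i> * of_real x)"
        "exp (\<i> * of_real (\<omega> * x))"]
    by (simp only: norm_rat_eval_imaginary[OF assms(1)] norm_exp_i_times)
  then show "bdd_above ((\<lambda>x::real. cmod (rat_eval (Fract (poly_dagger p) p) (\<i> * of_real x)
      - exp (\<i> * of_real (\<omega> * x)))) ` {- 1..1})"
    by (intro bdd_aboveI[where M = 2]) auto
qed

lemma approx_error_nonneg:
  assumes "p \<noteq> 0"
  shows "0 \<le> approx_error \<omega> (Fract (poly_dagger p) p)"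
  by (rule order_trans[OF norm_ge_zero norm_diff_le_approx_error[OF assms, of 0]]) simp

section \<open>Existence of a best approximation\<close>

text \<open>
  Any norm on the coefficient space would do; the sum of moduli passes directly to coefficientwise
  limits.
\<close>

definition coeff_norm :: "nat \<Rightarrow> complex poly \<Rightarrow> real" where
  "coeff_norm n p = (\<Sum>i\<le>n. cmod (coeff p i))"

lemma Fract_dagger_normalized:
  assumes "p \<noteq> 0" "degree p \<le> n"
  obtains q where "q \<noteq> 0" "degree q \<le> n" "coeff_norm n q = 1"
    "Fract (poly_dagger q) q = Fract (poly_dagger p) p"
proof -
  define c where "c = coeff_norm n p"
  have "0 < cmod (coeff p (degree p))" using assms by simp
  also have "\<dots> \<le> c"
    unfolding c_def coeff_norm_def by (rule member_le_sum) (use assms in auto)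
  finally have c: "0 < c" .
  define q where "q = smult (of_real (inverse c)) p"
  have 1: "q \<noteq> 0" using c assms by (simp add: q_def)
  have 2: "degree q \<le> n" using assms by (simp add: q_def)
  have "coeff_norm n q = inverse c * c"
    unfolding c_def
    by (simp add: coeff_norm_def q_def norm_mult norm_inverse sum_distrib_left c_def[symmetric])
       (use c in \<open>simp add: c_def coeff_norm_def\<close>)
  then have 3: "coeff_norm n q = 1" using c by simp
  have "Fract (poly_dagger q) q = Fract (poly_dagger p) p"
    using 1 assms by (simp add: eq_fract poly_dagger_smult q_def)
  with 1 2 3 show ?thesis using that by blast
qed

lemma convergent_subseq_coordinates:
  fixes f :: "nat \<Rightarrow> nat \<Rightarrow> complex"
  assumes "\<And>i k. i < m \<Longrightarrow> cmod (f k i) \<le> B"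
  shows "\<exists>r. strict_mono r \<and> (\<forall>i<m. convergent (\<lambda>k. f (r k) i))"
  using assms
proof (induction m)
  case 0
  show ?case by (rule exI[of _ id]) (simp add: strict_mono_def)
next
  case (Suc m)
  then obtain r where r: "strict_mono r" "\<forall>i<m. convergent (\<lambda>k. f (r k) i)"
    using less_SucI by metis
  have "seq_compact (cball (0::complex) B)" by (simp add: compact_imp_seq_compact)
  moreover have "\<forall>k. f (r k) m \<in> cball 0 B" using Suc.prems by simp
  ultimately obtain l s where s: "strict_mono s" "((\<lambda>k. f (r k) m) \<circ> s) \<longlonglongrightarrow> l"
    unfolding seq_compact_def by metis
  have "convergent (\<lambda>k. f ((r \<circ> s) k) i)" if "i < Suc m" for i
  proof (cases "i = m")
    case True
    then show ?thesis using s(2) by (auto simp: convergent_def o_def)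
  next
    case False
    with that r(2) have "convergent (\<lambda>k. f (r k) i)" by simp
    from convergent_subseq_convergent[OF this s(1)] show ?thesis by (simp add: o_def)
  qed
  moreover have "strict_mono (r \<circ> s)" using r(1) s(1) by (rule strict_mono_o)
  ultimately show ?case by blast
qed

text \<open>
  The limit \<open>p\<close> of normalised minimising denominators is nonzero because the normalisation
  survives in the limit. Its zeros on the imaginary axis, which the \<open>q k\<close> may lack, are harmless:
  the error of the limit is at most the infimum off these zeros, and it is continuous in the point.
\<close>

lemma unitary_best_approx_exists: "\<exists>u. unitary_best_approx n \<omega> u"
proof -
  define Q where "Q = {q. q \<noteq> 0 \<and> degree q \<le> n \<and> coeff_norm n q = 1}"
  define err where "err q = approx_error \<omega> (Fract (poly_dagger q) q)" for q
  define e where "e = Inf (err ` Q)"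
  obtain q0 where "q0 \<in> Q"
    unfolding Q_def by (rule Fract_dagger_normalized[of 1 n]) simp_all
  have bdd: "bdd_below (err ` Q)"
    by (rule bdd_belowI[where m = 0]) (auto simp: err_def Q_def approx_error_nonneg)
  have e_le: "e \<le> err q" if "q \<in> Q" for q
    unfolding e_def using bdd that by (rule cINF_lower)
  have "\<exists>q\<in>Q. err q < e + 1 / real (Suc k)" for k
    using cINF_less_iff[OF _ bdd, of "e + 1 / real (Suc k)"] \<open>q0 \<in> Q\<close> unfolding e_def by auto
  then obtain q where q: "\<And>k. q k \<in> Q" "\<And>k. err (q k) < e + 1 / real (Suc k)" by metis
  have "cmod (coeff (q k) i) \<le> 1" if "i < Suc n" for k i
  proof -
    have "cmod (coeff (q k) i) \<le> coeff_norm n (q k)"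
      unfolding coeff_norm_def by (rule member_le_sum) (use that in auto)
    then show ?thesis using q(1)[of k] by (simp add: Q_def)
  qed
  from convergent_subseq_coordinates[where f = "\<lambda>k. coeff (q k)", OF this] obtain r where r: "strict_mono r"
    and "\<forall>i<Suc n. convergent (\<lambda>k. coeff (q (r k)) i)" by blast
  then obtain l where l: "\<And>i. i \<le> n \<Longrightarrow> (\<lambda>k. coeff (q (r k)) i) \<longlonglongrightarrow> l i"
    unfolding convergent_def less_Suc_eq_le by metis
  define p where "p = (\<Sum>i\<le>n. monom (l i) i)"
  have coeff_p: "coeff p i = (if i \<le> n then l i else 0)" for i
    by (simp add: p_def coeff_sum)
  have deg_p: "degree p \<le> n" by (rule degree_le) (simp add: coeff_p)
  have "(\<lambda>k. coeff_norm n (q (r k))) \<longlonglongrightarrow> coeff_norm n p"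
    unfolding coeff_norm_def by (intro tendsto_intros) (simp add: coeff_p l)
  moreover have "coeff_norm n (q (r k)) = 1" for k using q(1)[of "r k"] by (simp add: Q_def)
  ultimately have "coeff_norm n p = 1" by (simp add: LIMSEQ_const_iff)
  then have p0: "p \<noteq> 0" by (auto simp: coeff_norm_def)
  have poly_lim: "(\<lambda>k. poly (q (r k)) z) \<longlonglongrightarrow> poly p z" for z
  proof -
    have *: "poly f z = (\<Sum>i\<le>n. coeff f i * z ^ i)" if "degree f \<le> n" for f
      unfolding poly_altdef
      by (rule sum.mono_neutral_left) (use that in \<open>auto simp: coeff_eq_0\<close>)
    have "degree (q (r k)) \<le> n" for k using q(1)[of "r k"] by (simp add: Q_def)
    then have eq: "poly (q (r k)) z = (\<Sum>i\<le>n. coeff (q (r k)) i * z ^ i)" for k by (rule *)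
    show ?thesis
      unfolding eq *[OF deg_p]
      by (intro tendsto_intros) (simp add: coeff_p l)
  qed
  have err_lim: "(\<lambda>k. e + 1 / real (Suc (r k))) \<longlonglongrightarrow> e"
  proof -
    have "(\<lambda>k. 1 / real (Suc k)) \<longlonglongrightarrow> 0"
      using LIMSEQ_inverse_real_of_nat by (simp add: inverse_eq_divide)
    from LIMSEQ_subseq_LIMSEQ[OF this r] have "(\<lambda>k. 1 / real (Suc (r k))) \<longlonglongrightarrow> 0"
      by (simp add: o_def)
    from tendsto_add[OF tendsto_const this] show ?thesis by simp
  qed
  \<comment> \<open>Where \<open>p\<close> does not vanish, neither do the later \<open>q (r k)\<close>, and the values converge.\<close>
  have off: "cmod (rat_eval (Fract (poly_dagger p) p) (\<i> * of_real x) - exp (\<i> * of_real (\<omega> * x)))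
      \<le> e" if x: "x \<in> {-1..1}" and nz: "poly p (\<i> * of_real x) \<noteq> 0" for x
  proof (rule tendsto_le[OF sequentially_bot err_lim])
    let ?z = "\<i> * of_real x :: complex"
    have lim: "(\<lambda>k. cmod (poly (poly_dagger (q (r k))) ?z / poly (q (r k)) ?z
          - exp (\<i> * of_real (\<omega> * x))))
        \<longlonglongrightarrow> cmod (poly (poly_dagger p) ?z / poly p ?z - exp (\<i> * of_real (\<omega> * x)))"
      unfolding poly_dagger_imaginary using nz by (intro tendsto_intros poly_lim)
    have ev: "\<forall>\<^sub>F k in sequentially. poly (q (r k)) ?z \<noteq> 0"
      using poly_lim nz by (rule tendsto_imp_eventually_ne)
    show "(\<lambda>k. cmod (rat_eval (Fract (poly_dagger (q (r k))) (q (r k))) ?z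
          - exp (\<i> * of_real (\<omega> * x))))
        \<longlonglongrightarrow> cmod (rat_eval (Fract (poly_dagger p) p) ?z - exp (\<i> * of_real (\<omega> * x)))"
      unfolding rat_eval_Fract[OF nz]
      by (rule Lim_transform_eventually[OF lim]) (use ev in eventually_elim, simp add: rat_eval_Fract)
    have "cmod (rat_eval (Fract (poly_dagger (q (r k))) (q (r k))) ?z - exp (\<i> * of_real (\<omega> * x)))
        \<le> e + 1 / real (Suc (r k))" for k
    proof -
      have "q (r k) \<noteq> 0" using q(1)[of "r k"] by (simp add: Q_def)
      from norm_diff_le_approx_error[OF this x, of \<omega>] q(2)[of "r k"] show ?thesis
        by (simp add: err_def)
    qed
    then show "\<forall>\<^sub>F k in sequentially.
        cmod (rat_eval (Fract (poly_dagger (q (r k))) (q (r k))) ?z - exp (\<i> * of_real (\<omega> * x)))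
        \<le> e + 1 / real (Suc (r k))" by simp
  qed
  have "approx_error \<omega> (Fract (poly_dagger p) p) \<le> e"
    unfolding approx_error_def
  proof (rule cSUP_least)
    fix x :: real assume x: "x \<in> {-1..1}"
    have "continuous_on UNIV (\<lambda>x. cmod (rat_eval (Fract (poly_dagger p) p) (\<i> * of_real x)
        - exp (\<i> * of_real (\<omega> * x))))"
      by (intro continuous_intros continuous_on_rat_eval_imaginary p0)
    from this finite_imaginary_roots[OF p0] _ _ x
    show "cmod (rat_eval (Fract (poly_dagger p) p) (\<i> * of_real x)
        - exp (\<i> * of_real (\<omega> * x))) \<le> e"
      by (rule le_of_le_off_finite) (use off in auto)
  qed simp
  moreover have "e \<le> approx_error \<omega> v" if v: "v \<in> unitary_rats n" for v
  proof -
    from v obtain f where f: "v = Fract (poly_dagger f) f" "f \<noteq> 0" "degree f \<le> n"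
      by (auto simp: unitary_rats_def)
    from f(2,3) obtain g where "g \<in> Q" "Fract (poly_dagger g) g = v"
      unfolding f(1) Q_def by (rule Fract_dagger_normalized) auto
    then show ?thesis using e_le by (force simp: err_def)
  qed
  moreover have "Fract (poly_dagger p) p \<in> unitary_rats n"
    using p0 deg_p by (auto simp: unitary_rats_def)
  ultimately have "unitary_best_approx n \<omega> (Fract (poly_dagger p) p)"
    unfolding unitary_best_approx_def is_arg_min_def by force
  then show ?thesis by blast
qed

section \<open>Reverse Bessel polynomials\<close>

text \<open>
  This is the usual \<open>\<theta>\<^sub>n (z) = \<Sum>\<^sub>k (2n - k)! / (k! (n - k)!) 2\<^sup>k\<^sup>-\<^sup>n z\<^sup>k\<close>. The recursion through the
  derivative replaces the three-term recurrence as definition because it has one predecessor only;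
  for \<open>g\<^sub>n (z) = exp (- z) \<theta>\<^sub>n (z)\<close> it reads \<open>g\<^sub>n\<^sub>+\<^sub>1 = (2n+1) g\<^sub>n - z g\<^sub>n'\<close>.
\<close>

fun reverse_bessel :: "nat \<Rightarrow> complex poly" where
  "reverse_bessel 0 = 1"
| "reverse_bessel (Suc n) = of_nat (2 * n + 1) * reverse_bessel n
     + [:0, 1:] * (reverse_bessel n - pderiv (reverse_bessel n))"

lemma degree_reverse_bessel: "degree (reverse_bessel n) \<le> n"
proof (induction n)
  case (Suc n)
  have "degree (reverse_bessel n - pderiv (reverse_bessel n)) \<le> n"
    using Suc by (intro degree_diff_le) (auto simp: degree_pderiv)
  then have "degree ([:0, 1:] * (reverse_bessel n - pderiv (reverse_bessel n))) \<le> Suc n"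
    by (intro order_trans[OF degree_mult_le]) simp
  moreover have "degree (of_nat (2 * n + 1) * reverse_bessel n) \<le> Suc n"
    using Suc by (intro order_trans[OF degree_mult_le]) (simp only: degree_of_nat)
  ultimately show ?case by (simp only: reverse_bessel.simps) (rule degree_add_le)
qed simp

text \<open>
  In terms of \<open>g\<^sub>n (z) = exp (- z) \<theta>\<^sub>n (z)\<close> this says \<open>g\<^sub>n\<^sub>+\<^sub>1' = - z g\<^sub>n\<close>. In the induction step the
  hypothesis turns the defining recursion into the three-term recurrence, which is differentiated.
\<close>

lemma pderiv_reverse_bessel:
  "pderiv (reverse_bessel (Suc n)) = reverse_bessel (Suc n) - [:0, 1:] * reverse_bessel n"
proof (induction n)
  case (Suc n)
  let ?x = "[:0, 1:] :: complex poly"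
  have x': "pderiv ?x = 1" by (simp add: pderiv_pCons)
  have rec: "reverse_bessel (Suc (Suc n)) = of_nat (2 * n + 3) * reverse_bessel (Suc n)
      + ?x * (?x * reverse_bessel n)"
    by (subst reverse_bessel.simps(2), subst Suc) (simp add: algebra_simps)
  have n: "reverse_bessel (Suc n) = of_nat (2 * n + 1) * reverse_bessel n
     + ?x * (reverse_bessel n - pderiv (reverse_bessel n))" by simp
  have "pderiv (reverse_bessel (Suc (Suc n))) = of_nat (2 * n + 3) * pderiv (reverse_bessel (Suc n))
      + (?x * (?x * pderiv (reverse_bessel n) + reverse_bessel n) + ?x * reverse_bessel n)"
    unfolding rec pderiv_add pderiv_mult x' pderiv_of_nat
    by (simp only: mult_1_right mult_zero_right add_0_right)
  also have "\<dots> = of_nat (2 * n + 3) * reverse_bessel (Suc n) + ?x * (?x * reverse_bessel n)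
      - ?x * (of_nat (2 * n + 1) * reverse_bessel n
         + ?x * (reverse_bessel n - pderiv (reverse_bessel n)))"
    unfolding Suc of_nat_add of_nat_mult of_nat_numeral of_nat_1 by algebra
  finally show ?case unfolding rec n[symmetric] .
qed (simp add: pderiv_add pderiv_pCons)

lemma reverse_bessel_three_term:
  "reverse_bessel (Suc (Suc n)) = of_nat (2 * n + 3) * reverse_bessel (Suc n)
      + [:0, 1:] * ([:0, 1:] * reverse_bessel n)"
  by (subst reverse_bessel.simps(2), subst pderiv_reverse_bessel) (simp add: algebra_simps)

text \<open>
  The factor \<open>exp (- \<i> y)\<close> removes from the reverse Bessel polynomial on the imaginary axis the
  phase that the Pade quotient has to approximate, so the imaginary part measures the remaining
  phase error.
\<close>

definition twisted :: "nat \<Rightarrow> real \<Rightarrow> complex" where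
  "twisted n y = exp (- (\<i> * of_real y)) * poly (reverse_bessel n) (\<i> * of_real y)"

lemma twisted_0: "twisted 0 y = exp (- (\<i> * of_real y))"
  by (simp add: twisted_def)

lemma twisted_1: "twisted (Suc 0) y = (1 + \<i> * of_real y) * twisted 0 y"
  by (simp add: twisted_def algebra_simps)

lemma twisted_three_term:
  "twisted (Suc (Suc n)) y = of_real (2 * real n + 3) * twisted (Suc n) y
    - of_real (y\<^sup>2) * twisted n y"
  unfolding twisted_def reverse_bessel_three_term
  by (simp add: algebra_simps power2_eq_square)

lemma twisted_derivative:
  "(twisted (Suc n) has_vector_derivative of_real y * twisted n y) (at y)"
proof -
  have "((\<lambda>z. exp (- z) * poly (reverse_bessel (Suc n)) z) has_field_derivative
      - exp (- z) * poly (reverse_bessel (Suc n)) z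
      + exp (- z) * poly (pderiv (reverse_bessel (Suc n))) z) (at z)" for z
    by (auto intro!: derivative_eq_intros simp del: reverse_bessel.simps)
  then have *: "((\<lambda>z. exp (- z) * poly (reverse_bessel (Suc n)) z) has_field_derivative
      - (z * (exp (- z) * poly (reverse_bessel n) z))) (at z)" for z
    unfolding pderiv_reverse_bessel by (simp add: algebra_simps del: reverse_bessel.simps)
  have "((\<lambda>y. \<i> * of_real y) has_vector_derivative \<i>) (at y)"
    by (auto intro!: derivative_eq_intros)
  from field_vector_diff_chain_at[OF this *] show ?thesis
    by (simp add: o_def twisted_def[abs_def] algebra_simps del: reverse_bessel.simps)
qed

text \<open>
  The double factorial \<open>(2n - 1)!!\<close>, as a real number.
\<close>

definition odd_prod :: "nat \<Rightarrow> real" where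
  "odd_prod n = (\<Prod>k<n. 2 * real k + 1)"

lemma odd_prod_0 [simp]: "odd_prod 0 = 1"
  and odd_prod_Suc: "odd_prod (Suc n) = (2 * real n + 1) * odd_prod n"
  by (simp_all add: odd_prod_def)

lemma odd_prod_pos: "0 < odd_prod n"
  by (auto simp: odd_prod_def intro!: prod_pos)

lemma odd_prod_fact: "odd_prod n * (2 ^ n * fact n) = fact (2 * n)"
proof (induction n)
  case (Suc n)
  have "odd_prod (Suc n) * (2 ^ Suc n * fact (Suc n))
      = real (2 * n + 2) * (real (2 * n + 1) * (odd_prod n * (2 ^ n * fact n)))"
    by (simp add: odd_prod_Suc algebra_simps)
  then show ?case by (simp only: Suc) simp
qed simp

lemma odd_prod_Suc_fact: "odd_prod (Suc n) * (2 ^ n * fact n) = fact (2 * n + 1)"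
  using odd_prod_fact[of n] by (simp add: odd_prod_Suc mult.assoc)

lemma twisted_at_0: "twisted n 0 = of_real (odd_prod n)"
  by (induction n) (simp_all add: twisted_def odd_prod_Suc)

section \<open>The imaginary part is small, the modulus is large\<close>

text \<open>
  The exponent of the bound on the derivative is even, so that the majorant is nonnegative on both
  sides of zero and one integration serves positive and negative arguments alike.
\<close>

lemma abs_le_power_of_deriv_le:
  fixes f f' :: "real \<Rightarrow> real"
  assumes "f 0 = 0" and f': "\<And>t. (f has_real_derivative f' t) (at t)"
    and le: "\<And>t. \<bar>f' t\<bar> \<le> c * t ^ (2 * m)" and "0 \<le> c"
  shows "\<bar>f y\<bar> \<le> c * \<bar>y\<bar> ^ (2 * m + 1) / real (2 * m + 1)"
proof -
  define h where "h y = c * y ^ (2 * m + 1) / real (2 * m + 1)" for y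
  have h': "(h has_real_derivative c * t ^ (2 * m)) (at t)" for t
    unfolding h_def[abs_def] by (rule derivative_eq_intros refl | simp)+
  \<comment> \<open>Both \<open>h + f\<close> and \<open>h - f\<close> increase and vanish at zero, so their sign is that of \<open>y\<close>.\<close>
  have "mono (\<lambda>t. h t + f t)"
    by (rule monoI, rule DERIV_nonneg_imp_nondecreasing, assumption)
       (use le DERIV_add[OF h' f'] in \<open>smt (verit)\<close>)
  moreover have "mono (\<lambda>t. h t - f t)"
    by (rule monoI, rule DERIV_nonneg_imp_nondecreasing, assumption)
       (use le DERIV_diff[OF h' f'] in \<open>smt (verit)\<close>)
  moreover have "h 0 = 0" by (simp add: h_def)
  ultimately have "\<bar>f y\<bar> \<le> \<bar>h y\<bar>"
    using \<open>f 0 = 0\<close> linear[of 0 y] unfolding mono_def by (smt (verit))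
  also have "\<bar>h y\<bar> = c * \<bar>y\<bar> ^ (2 * m + 1) / real (2 * m + 1)"
    using \<open>0 \<le> c\<close> by (simp add: h_def abs_mult power_abs)
  finally show ?thesis .
qed

text \<open>
  Each integration of \<open>y \<mapsto> y Im G\<^sub>n (y)\<close> raises the order by two and divides by the next odd
  number. No constant of integration enters since \<open>G\<^sub>n (0)\<close> is real.
\<close>

lemma Im_twisted_le: "\<bar>Im (twisted n y)\<bar> \<le> \<bar>y\<bar> ^ (2 * n + 1) / odd_prod (Suc n)"
proof (induction n arbitrary: y)
  case 0
  have "twisted 0 y = cis (- y)" by (simp add: twisted_0 cis_conv_exp)
  then show ?case using abs_sin_x_le_abs_x[of y] by (simp add: odd_prod_Suc)
next
  case (Suc n)
  have "\<bar>Im (twisted (Suc n) y)\<bar>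
      \<le> 1 / odd_prod (Suc n) * \<bar>y\<bar> ^ (2 * Suc n + 1) / real (2 * Suc n + 1)"
  proof (rule abs_le_power_of_deriv_le)
    show "((\<lambda>t. Im (twisted (Suc n) t)) has_real_derivative t * Im (twisted n t)) (at t)" for t
      using bounded_linear.has_vector_derivative[OF bounded_linear_Im twisted_derivative]
      by (simp add: has_real_derivative_iff_has_vector_derivative)
    show "\<bar>t * Im (twisted n t)\<bar> \<le> 1 / odd_prod (Suc n) * t ^ (2 * Suc n)" for t
    proof -
      have "\<bar>t * Im (twisted n t)\<bar> \<le> \<bar>t\<bar> * (\<bar>t\<bar> ^ (2 * n + 1) / odd_prod (Suc n))"
        unfolding abs_mult by (rule mult_left_mono[OF Suc]) simp
      also have "\<dots> = 1 / odd_prod (Suc n) * \<bar>t\<bar> ^ (2 * Suc n)" by simp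
      also have "\<bar>t\<bar> ^ (2 * Suc n) = t ^ (2 * Suc n)" by (rule power_even_abs) simp
      finally show ?thesis .
    qed
  qed (use odd_prod_pos[of "Suc n"] in \<open>simp_all add: twisted_at_0\<close>)
  also have "\<dots> = \<bar>y\<bar> ^ (2 * Suc n + 1) / odd_prod (Suc (Suc n))"
    by (simp add: odd_prod_Suc[of "Suc n"] add.commute)
  finally show ?case .
qed

text \<open>
  The coefficient of \<open>y\<^sup>2\<^sup>k\<close> in \<open>\<bar>\<theta>\<^sub>n (\<i> y)\<bar>\<^sup>2\<close>. The recursion in \<open>n\<close> comes from integrating the
  derivative of the squared modulus in \<open>twisted_modulus\<close>.
\<close>

fun modulus_coeff :: "nat \<Rightarrow> nat \<Rightarrow> real" where
  "modulus_coeff 0 k = (if k = 0 then 1 else 0)"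
| "modulus_coeff (Suc n) 0 = (odd_prod (Suc n))\<^sup>2"
| "modulus_coeff (Suc n) (Suc k) = (2 * real n + 1 - real k) / (real k + 1) * modulus_coeff n k"

lemma modulus_coeff_0: "modulus_coeff n 0 = (odd_prod n)\<^sup>2"
  by (cases n) simp_all

text \<open>
  For \<open>k \<le> n\<close> the factor \<open>2n + 1 - k\<close> in the recursion is positive.
\<close>

lemma modulus_coeff_nonneg: "k \<le> n \<Longrightarrow> 0 \<le> modulus_coeff n k"
  by (induction n k rule: modulus_coeff.induct) auto

text \<open>
  With \<open>M\<^sub>n = \<bar>G\<^sub>n\<bar>\<^sup>2\<close> and \<open>c\<^sub>n = Re (cnj G\<^sub>n\<^sub>+\<^sub>1 G\<^sub>n)\<close>, the relation \<open>G\<^sub>n\<^sub>+\<^sub>1' (y) = y G\<^sub>n (y)\<close> gives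
  \<open>M\<^sub>n\<^sub>+\<^sub>1' (y) = 2 y c\<^sub>n (y)\<close>, and the three-term recurrence gives
  \<open>c\<^sub>n\<^sub>+\<^sub>1 = (2n+3) M\<^sub>n\<^sub>+\<^sub>1 - y\<^sup>2 c\<^sub>n\<close>. The minus sign could spoil positivity, but by the first identity
  \<open>y\<^sup>2 c\<^sub>n = y M\<^sub>n\<^sub>+\<^sub>1' / 2\<close>, so subtracting it only lowers the factor at \<open>y\<^sup>2\<^sup>k\<close> from \<open>2n + 3\<close> to
  \<open>2n + 3 - k\<close>. Hence both expansions have to be carried through the induction together.
\<close>

lemma twisted_modulus:
  "(cmod (twisted n y))\<^sup>2 = (\<Sum>k\<le>n. modulus_coeff n k * y ^ (2 * k))"
  "Re (cnj (twisted (Suc n) y) * twisted n y)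
    = (\<Sum>k\<le>n. (2 * real n + 1 - real k) * modulus_coeff n k * y ^ (2 * k))"
proof (induction n arbitrary: y)
  case 0
  case 1
  show ?case by (simp add: twisted_0)
next
  case 0
  case 2
  have "(cmod (twisted 0 y))\<^sup>2 = 1" by (simp add: twisted_0)
  then have "twisted 0 y * cnj (twisted 0 y) = 1" by (simp add: complex_norm_square[symmetric])
  then have "cnj (twisted (Suc 0) y) * twisted 0 y = 1 - \<i> * of_real y"
    by (simp add: twisted_1 algebra_simps)
  then show ?case by simp
next
  case (Suc n)
  let ?c = "\<lambda>y. \<Sum>k\<le>n. (2 * real n + 1 - real k) * modulus_coeff n k * y ^ (2 * k)"
  \<comment> \<open>Both sides have the same derivative and the same value at zero.\<close>
  have M: "(cmod (twisted (Suc n) y))\<^sup>2 = (\<Sum>k\<le>Suc n. modulus_coeff (Suc n) k * y ^ (2 * k))" for y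
  proof -
    have L: "((\<lambda>y. (cmod (twisted (Suc n) y))\<^sup>2) has_real_derivative 2 * y * ?c y) (at y)" for y
    proof -
      have "((\<lambda>y. twisted (Suc n) y \<bullet> twisted (Suc n) y) has_vector_derivative
          (twisted (Suc n) y \<bullet> (of_real y * twisted n y)
            + (of_real y * twisted n y) \<bullet> twisted (Suc n) y)) (at y)"
        by (rule bounded_bilinear.has_vector_derivative[OF bounded_bilinear_inner
              twisted_derivative twisted_derivative])
      also have "twisted (Suc n) y \<bullet> (of_real y * twisted n y)
            + (of_real y * twisted n y) \<bullet> twisted (Suc n) y
          = 2 * y * Re (cnj (twisted (Suc n) y) * twisted n y)"
        by (simp add: inner_complex_def algebra_simps)
      finally show ?thesis
        by (simp only: has_real_derivative_iff_has_vector_derivative power2_norm_eq_inner Suc.IH(2))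
    qed
    have R: "((\<lambda>y. \<Sum>k\<le>Suc n. modulus_coeff (Suc n) k * y ^ (2 * k))
        has_real_derivative 2 * y * ?c y) (at y)" for y
    proof -
      have "((\<lambda>y. \<Sum>k\<le>Suc n. modulus_coeff (Suc n) k * y ^ (2 * k)) has_real_derivative
          (\<Sum>k\<le>Suc n. modulus_coeff (Suc n) k * (real (2 * k) * y ^ (2 * k - 1)))) (at y)"
        unfolding One_nat_def by (intro DERIV_sum DERIV_cmult DERIV_pow)
      also have "(\<Sum>k\<le>Suc n. modulus_coeff (Suc n) k * (real (2 * k) * y ^ (2 * k - 1)))
          = (\<Sum>k\<le>n. modulus_coeff (Suc n) (Suc k) * (real (2 * Suc k) * y ^ (2 * Suc k - 1)))"
        by (subst sum.atMost_Suc_shift) simp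
      also have "\<dots> = 2 * y * ?c y"
        unfolding sum_distrib_left by (rule sum.cong) (auto simp: field_simps)
      finally show ?thesis .
    qed
    have "((\<lambda>y. (cmod (twisted (Suc n) y))\<^sup>2 - (\<Sum>k\<le>Suc n. modulus_coeff (Suc n) k * y ^ (2 * k)))
        has_real_derivative 0) (at y)" for y
      using DERIV_diff[OF L R] by simp
    then have "(cmod (twisted (Suc n) y))\<^sup>2 - (\<Sum>k\<le>Suc n. modulus_coeff (Suc n) k * y ^ (2 * k))
       = (cmod (twisted (Suc n) 0))\<^sup>2 - (\<Sum>k\<le>Suc n. modulus_coeff (Suc n) k * 0 ^ (2 * k))"
      by (intro DERIV_isconst_all) blast
    also have "\<dots> = 0"
      by (subst sum.atMost_Suc_shift) (simp add: twisted_at_0)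
    finally show ?thesis by simp
  qed
  {
    case 1
    show ?case by (rule M)
  next
    case 2
    have "Re (cnj (twisted (Suc (Suc n)) y) * twisted (Suc n) y)
        = (2 * real n + 3) * (cmod (twisted (Suc n) y))\<^sup>2
          - y\<^sup>2 * Re (cnj (twisted (Suc n) y) * twisted n y)"
      unfolding twisted_three_term cmod_power2 by (simp add: algebra_simps power2_eq_square)
    also have "y\<^sup>2 * Re (cnj (twisted (Suc n) y) * twisted n y)
        = (\<Sum>k\<le>n. real (Suc k) * modulus_coeff (Suc n) (Suc k) * y ^ (2 * Suc k))"
      unfolding Suc.IH(2) sum_distrib_left
      by (rule sum.cong) (auto simp: field_simps power2_eq_square)
    also have "\<dots> = (\<Sum>k\<le>Suc n. real k * modulus_coeff (Suc n) k * y ^ (2 * k))"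
      by (subst sum.atMost_Suc_shift) simp
    also have "(2 * real n + 3) * (cmod (twisted (Suc n) y))\<^sup>2 - \<dots>
        = (\<Sum>k\<le>Suc n. (2 * real (Suc n) + 1 - real k) * modulus_coeff (Suc n) k * y ^ (2 * k))"
      unfolding M sum_distrib_left sum_subtractf[symmetric]
      by (rule sum.cong) (auto simp: algebra_simps)
    finally show ?case .
  }
qed

lemma norm_twisted_ge: "odd_prod n \<le> cmod (twisted n y)"
proof (rule power2_le_imp_le)
  have "modulus_coeff n 0 * y ^ (2 * 0) \<le> (\<Sum>k\<le>n. modulus_coeff n k * y ^ (2 * k))"
    by (rule member_le_sum) (auto simp: modulus_coeff_nonneg)
  then show "(odd_prod n)\<^sup>2 \<le> (cmod (twisted n y))\<^sup>2"
    by (simp add: twisted_modulus(1) modulus_coeff_0)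
qed simp

section \<open>The Pade approximant\<close>

text \<open>
  With \<open>w = exp (\<i> y)\<close> and \<open>y = - \<omega> x / 2\<close> the denominator at \<open>\<i> x\<close> is \<open>w G\<^sub>n (y)\<close> and the numerator its
  conjugate, while the exponential is \<open>cnj w / w\<close>. The error is therefore
  \<open>\<bar>cnj G\<^sub>n (y) - G\<^sub>n (y)\<bar> / \<bar>G\<^sub>n (y)\<bar>\<close>, and the bounds on imaginary part and modulus apply.
\<close>

lemma pade_approx_error:
  assumes "\<omega> > 0"
  shows "\<exists>u\<in>unitary_rats n. approx_error \<omega> u
    \<le> (fact n)\<^sup>2 * \<omega> ^ (2 * n + 1) / (fact (2 * n) * fact (2 * n + 1))"
proof -
  define p where "p = pcompose (reverse_bessel n) [:0, - of_real (\<omega> / 2):]"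
  have p: "poly p (\<i> * of_real x) = exp (- (\<i> * of_real (\<omega> * x / 2))) * twisted n (- (\<omega> * x / 2))"
    for x :: real
    by (simp add: p_def twisted_def poly_pcompose exp_minus algebra_simps)
  have nz: "poly p (\<i> * of_real x) \<noteq> 0" for x :: real
    using norm_twisted_ge[of n "- (\<omega> * x / 2)"] odd_prod_pos[of n] by (auto simp: p)
  then have "p \<noteq> 0" by auto
  moreover have "degree p \<le> n"
    using degree_pcompose_le[of "reverse_bessel n" "[:0, - of_real (\<omega> / 2):]"]
      degree_reverse_bessel[of n] \<open>\<omega> > 0\<close> by (simp add: p_def)
  ultimately have "Fract (poly_dagger p) p \<in> unitary_rats n" by (auto simp: unitary_rats_def)
  moreover have "approx_error \<omega> (Fract (poly_dagger p) p)
      \<le> (fact n)\<^sup>2 * \<omega> ^ (2 * n + 1) / (fact (2 * n) * fact (2 * n + 1))"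
    unfolding approx_error_def
  proof (rule cSUP_least)
    fix x :: real assume x: "x \<in> {-1..1}"
    define y where "y = - (\<omega> * x / 2)"
    define w where "w = exp (\<i> * of_real y)"
    have w: "cmod w = 1" by (simp add: w_def)
    then have ww: "w * cnj w = 1" by (simp add: complex_norm_square[symmetric])
    have "\<i> * complex_of_real (\<omega> * x) = - (\<i> * of_real y) + - (\<i> * of_real y)"
      by (simp add: y_def)
    then have ex: "exp (\<i> * complex_of_real (\<omega> * x)) = cnj w * cnj w"
      by (simp only: exp_add w_def exp_cnj) simp
    have px: "poly p (\<i> * of_real x) = w * twisted n y"
      by (simp add: p w_def y_def)
    have t0: "twisted n y \<noteq> 0"
      using norm_twisted_ge[of n y] odd_prod_pos[of n] by auto
    have w0: "w \<noteq> 0" by (simp add: w_def)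
    \<comment> \<open>The factor \<open>w * cnj w\<close>, equal to one, is inserted to bring both terms over \<open>w\<close>.\<close>
    have "rat_eval (Fract (poly_dagger p) p) (\<i> * of_real x) - exp (\<i> * of_real (\<omega> * x))
        = cnj w * cnj (twisted n y) / (w * twisted n y)
          - cnj w * cnj w * (w * cnj w) / (w * cnj w)"
      by (simp only: rat_eval_Fract[OF nz] poly_dagger_imaginary px ex) (use w0 in simp)
    also have "\<dots> = cnj w / w * ((cnj (twisted n y) - twisted n y) / twisted n y)"
      using w0 t0 ww by (simp add: field_simps)
    finally have "cmod (rat_eval (Fract (poly_dagger p) p) (\<i> * of_real x)
          - exp (\<i> * of_real (\<omega> * x))) = cmod (cnj (twisted n y) - twisted n y) / cmod (twisted n y)"
      by (simp add: norm_mult norm_divide w)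
    also have "cnj (twisted n y) - twisted n y = - (2 * \<i> * of_real (Im (twisted n y)))"
      by (simp add: complex_eq_iff)
    also have "cmod \<dots> = 2 * \<bar>Im (twisted n y)\<bar>"
      by (simp add: norm_mult)
    also have "2 * \<bar>Im (twisted n y)\<bar> / cmod (twisted n y)
        \<le> 2 * (\<bar>y\<bar> ^ (2 * n + 1) / odd_prod (Suc n)) / odd_prod n"
      using Im_twisted_le[of n y] norm_twisted_ge[of n y] odd_prod_pos[of n]
      by (intro frac_le mult_left_mono) auto
    also have "\<dots> \<le> 2 * ((\<omega> / 2) ^ (2 * n + 1) / odd_prod (Suc n)) / odd_prod n"
    proof -
      have "\<bar>y\<bar> \<le> \<omega> / 2"
        using x \<open>\<omega> > 0\<close> by (simp add: y_def abs_mult mult_left_le abs_le_iff)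
      then have "\<bar>y\<bar> ^ (2 * n + 1) \<le> (\<omega> / 2) ^ (2 * n + 1)" by (intro power_mono) auto
      then show ?thesis
        using odd_prod_pos[of n] odd_prod_pos[of "Suc n"]
        by (intro divide_right_mono mult_left_mono) auto
    qed
    also have "\<dots> = (fact n)\<^sup>2 * \<omega> ^ (2 * n + 1) / (fact (2 * n) * fact (2 * n + 1))"
    proof -
      have "(2::real) ^ (2 * n + 1) = 2 * 2 ^ n * 2 ^ n"
        using power_add[of "2::real" n n] by (simp add: mult_2[symmetric])
      moreover have "2 * (W / (2 * t * t) / B) / A = f\<^sup>2 * W / (A * (t * f) * (B * (t * f)))"
        if "t \<noteq> 0" "f \<noteq> 0" "A \<noteq> 0" "B \<noteq> 0" for W t f A B :: real
        using that by (simp add: divide_simps power2_eq_square)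
      ultimately show ?thesis
        unfolding odd_prod_fact[symmetric] odd_prod_Suc_fact[symmetric] power_divide
        using odd_prod_pos[of n] odd_prod_pos[of "Suc n"] by (simp only:) simp
    qed
    finally show "cmod (rat_eval (Fract (poly_dagger p) p) (\<i> * of_real x)
          - exp (\<i> * of_real (\<omega> * x)))
        \<le> (fact n)\<^sup>2 * \<omega> ^ (2 * n + 1) / (fact (2 * n) * fact (2 * n + 1))" .
  qed simp
  ultimately show ?thesis by blast
qed

theorem proposition8p2:
  fixes n :: nat and \<omega> :: real
  assumes "n \<ge> 1" and "\<omega> > 0"
  shows "\<exists>u. unitary_best_approx n \<omega> u \<and>
    approx_error \<omega> u \<le> (fact n)\<^sup>2 * \<omega> ^ (2 * n + 1) / (fact (2 * n) * fact (2 * n + 1))"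
proof -
  obtain u where u: "unitary_best_approx n \<omega> u" using unitary_best_approx_exists by blast
  obtain v where v: "v \<in> unitary_rats n" "approx_error \<omega> v
      \<le> (fact n)\<^sup>2 * \<omega> ^ (2 * n + 1) / (fact (2 * n) * fact (2 * n + 1))"
    using pade_approx_error[OF \<open>\<omega> > 0\<close>] by blast
  have "approx_error \<omega> u \<le> approx_error \<omega> v"
    using u v(1) by (auto simp: unitary_best_approx_def is_arg_min_def not_less)
  with u v(2) show ?thesis by force
qed

end
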